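(* Let $r\ge2$, let $n_1,\dots,n_r$ be nonnegative integers and let $z_1,\dots,z_r\in\mathbb{C}$. Then \[ \zeta_r(-n_1,\dots,-n_r;z_1,\dots,z_{r-1},z_r+1)=\zeta_r(-n_1,\dots,-n_r;z_1,\dots,z_r)+(-1)^{n_r}\sum_{k=0}^{n_r}\binom{n_r}{k}z_r^{\,n_r-k}(-1)^k\,\zeta_{r-1}(-n_1,\dots,-n_{r-2},-n_{r-1}-k;z_1,\dots,z_{r-1}). \] Symbolically, the added term is $(-1)^{n_r}(z_r-\mathcal{Z}_{r-1})^{n_r}$ with $\mathcal{Z}_{r-1}^k$ evaluated as $\zeta_{r-1}(-n_1,\dots,-n_{r-1}-k;z_1,\dots,z_{r-1})$.
   Context: Bernoulli numbers $B_m$ are defined by $\frac{t}{e^t-1}=\sum_{m\ge0}B_m\frac{t^m}{m!}$. Bernoulli polynomials are $B_m(z)=\sum_{j=0}^m\binom{m}{j}B_jz^{m-j}$. For positive integers $a_1,\dots,a_k$ and complex $z_1,\dots,z_k$, define recursively $V(a_1;z_1)=B_{a_1}(z_1)/a_1$ and, for $k\ge2$, \[ V(a_1,\dots,a_k;z_1,\dots,z_k)=\frac{1}{a_k}\sum_{j=0}^{a_k}\binom{a_k}{j}B_{a_k-j}(z_k)\,V(a_1,\dots,a_{k-2},a_{k-1}+j;z_1,\dots,z_{k-1}). \] This is the evaluated value of the symbolic product $\prod_{i=1}^k\mathcal{C}^{a_i}_{1,\dots,i}(z_1,\dots,z_i)$, where \[ \mathcal{C}^n_1(z_1)=\frac{(z_1+\mathcal{B}_1)^n}{n},\qquad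 \mathcal{C}^n_{1,\dots,k+1}=\frac{(\mathcal{C}_{1,\dots,k}+\mathcal{B}_{k+1}+z_{k+1})^n}{n}, \] and $(\mathcal{B}_j+z_j)^m$ is evaluated as $B_m(z_j)$. The shifted multiple zeta value at negative integers (the paper's symbolic form of Sadaoui's analytic continuation) is \[ \zeta_r(-n_1,\dots,-n_r;z_1,\dots,z_r)=(-1)^{n_1+\dots+n_r}\,V(n_1+1,\dots,n_r+1;z_1,\dots,z_r). \] *)

theory Defs
  imports Complex_Main "HOL-Computational_Algebra.Formal_Power_Series"
    "HOL-Computational_Algebra.Polynomial"
begin

definition bernoulli_num :: "nat \<Rightarrow> complex" where
  "bernoulli_num m = fact m * fps_nth (fps_X / (fps_exp 1 - 1)) m"

definition bernoulli_poly :: "nat \<Rightarrow> complex \<Rightarrow> complex" where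
  "bernoulli_poly m z = (\<Sum>j=0..m. of_nat (m choose j) * bernoulli_num j * z ^ (m - j))"

text \<open>
  \<open>V k a z\<close> stands for $V(a_1,\dots,a_k;z_1,\dots,z_k)$. Tuples are functions on the indices
  \<open>1, \<dots>, k\<close>; values at other indices are never used. The value for \<open>k = 0\<close> is unspecified.
\<close>

fun V :: "nat \<Rightarrow> (nat \<Rightarrow> nat) \<Rightarrow> (nat \<Rightarrow> complex) \<Rightarrow> complex" where
  "V (Suc 0) a z = bernoulli_poly (a 1) (z 1) / of_nat (a 1)"
| "V (Suc (Suc k)) a z =
     1 / of_nat (a (k + 2)) *
     (\<Sum>j=0..a (k + 2). of_nat (a (k + 2) choose j) * bernoulli_poly (a (k + 2) - j) (z (k + 2)) *
        V (Suc k) (a(k + 1 := a (k + 1) + j)) z)"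

text \<open>
  \<open>zeta_neg r n z\<close> stands for $\zeta_r(-n_1,\dots,-n_r;z_1,\dots,z_r)$: the argument \<open>n\<close> carries
  the absolute values of the exponents.
\<close>

definition zeta_neg :: "nat \<Rightarrow> (nat \<Rightarrow> nat) \<Rightarrow> (nat \<Rightarrow> complex) \<Rightarrow> complex" where
  "zeta_neg r n z = (-1) ^ (\<Sum>i=1..r. n i) * V r (\<lambda>i. n i + 1) z"

text \<open>
  Evaluation of a polynomial expression \<open>p\<close> in a symbol whose \<open>k\<close>-th power evaluates to \<open>f k\<close>.
\<close>

definition umbral_eval :: "(nat \<Rightarrow> complex) \<Rightarrow> complex poly \<Rightarrow> complex" where
  "umbral_eval f p = (\<Sum>k\<le>degree p. coeff p k * f k)"

end

theory Submission
  imports Defs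
begin

text \<open>
  The generating function of the Bernoulli polynomials satisfies
  \<open>G e\<^bsup>(z+1)t\<^esup> - G e\<^bsup>zt\<^esup> = t e\<^bsup>zt\<^esup>\<close>, so \<open>B\<^sub>m(z+1) - B\<^sub>m(z) = m z\<^bsup>m-1\<^esup>\<close>.
  Only the outermost Bernoulli polynomials in the recursion for \<open>V\<close> depend on \<open>z\<^sub>r\<close>; with
  \<open>a\<^sub>r = n\<^sub>r + 1\<close>, the absorption identity
  \<open>(a\<^sub>r - j) binom(a\<^sub>r, j) = a\<^sub>r binom(n\<^sub>r, j)\<close> cancels the prefactor \<open>1/a\<^sub>r\<close>.
\<close>

text \<open>Division of power series cancels only when it is exact. Here it is, since numerator and
  denominator both have subdegree 1.\<close>

lemma fps_X_div_exp_minus_1_times: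
  "fps_X / (fps_exp 1 - 1) * (fps_exp 1 - 1) = (fps_X :: 'a :: field_char_0 fps)"
proof -
  have nz: "fps_exp 1 - 1 \<noteq> (0 :: 'a fps)"
    by (auto simp: fps_eq_iff intro!: exI[of _ 1])
  have "subdegree (fps_exp 1 - 1 :: 'a fps) = 1"
    by (rule subdegreeI) auto
  then have "fps_exp 1 - 1 dvd (fps_X :: 'a fps)"
    using nz by (subst fps_dvd_iff) auto
  then show ?thesis
    by (rule dvd_div_mult_self)
qed

text \<open>The Cauchy product of two exponential generating functions produces the binomial
  convolution that defines \<open>bernoulli_poly\<close>.\<close>

lemma fps_nth_bernoulli_poly:
  "fps_nth (fps_X / (fps_exp 1 - 1) * fps_exp z) m = bernoulli_poly m z / fact m"
proof -
  have "fps_nth (fps_X / (fps_exp 1 - 1) * fps_exp z) m =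
          (\<Sum>j=0..m. bernoulli_num j / fact j * (z ^ (m - j) / fact (m - j)))"
    by (simp add: fps_mult_nth bernoulli_num_def)
  also have "\<dots> = (\<Sum>j=0..m. of_nat (m choose j) * bernoulli_num j * z ^ (m - j) / fact m)"
    by (intro sum.cong refl) (simp add: binomial_fact field_simps)
  finally show ?thesis
    by (simp add: bernoulli_poly_def sum_divide_distrib)
qed

lemma bernoulli_poly_plus_1:
  "bernoulli_poly m (z + 1) = bernoulli_poly m z + of_nat m * z ^ (m - 1)"
proof -
  let ?G = "fps_X / (fps_exp 1 - 1) :: complex fps"
  have "?G * fps_exp (z + 1) = ?G * fps_exp z + ?G * (fps_exp 1 - 1) * fps_exp z"
    by (simp add: fps_exp_add_mult algebra_simps)
  also have "\<dots> = ?G * fps_exp z + fps_X * fps_exp z"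
    by (simp only: fps_X_div_exp_minus_1_times)
  finally have "fps_nth (?G * fps_exp (z + 1)) m = fps_nth (?G * fps_exp z + fps_X * fps_exp z) m"
    by simp
  \<comment> \<open>At \<open>m = 0\<close> the truncated exponent \<open>m - 1\<close> is harmless,
    because the factor \<open>of_nat m\<close> vanishes.\<close>
  moreover have "fps_nth (fps_X * fps_exp z) m = of_nat m * z ^ (m - 1) / fact m"
    by (cases m) (simp_all add: fact_Suc del: of_nat_Suc)
  ultimately show ?thesis
    by (simp add: fps_nth_bernoulli_poly flip: add_divide_distrib)
qed

text \<open>This makes precise that \<open>V k\<close> sees only the indices from 1 to
  \<open>k\<close>, so the inner values in the recursion do not notice a shift of the last
  variable.\<close>

lemma V_cong:
  assumes "\<And>i. 1 \<le> i \<Longrightarrow> i \<le> k \<Longrightarrow> a i = b i"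
    and "\<And>i. 1 \<le> i \<Longrightarrow> i \<le> k \<Longrightarrow> z i = w i" and "k \<ge> 1"
  shows "V k a z = V k b w"
  using assms
\<comment> \<open>The recursion raises an exponent by \<open>j\<close> on both sides, so
  \<open>b\<close> has to vary along with \<open>a\<close>.\<close>
proof (induction k a z arbitrary: b rule: V.induct)
  case (2 k a z)
  have "V (Suc k) (a(k + 1 := a (k + 1) + j)) z = V (Suc k) (b(k + 1 := b (k + 1) + j)) w"
    if "j \<in> {0..a (k + 2)}" for j
    by (rule "2.IH"[OF that]) (use "2.prems" in auto)
  moreover have "a (k + 2) = b (k + 2)" "z (k + 2) = w (k + 2)"
    using "2.prems" by auto
  ultimately show ?case
    by simp
qed auto

lemma V_shift_last:
  assumes "a (k + 2) = Suc m"
  shows "V (Suc (Suc k)) a (z(k + 2 := z (k + 2) + 1)) = V (Suc (Suc k)) a z +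
           (\<Sum>j=0..m. of_nat (m choose j) * z (k + 2) ^ (m - j) *
              V (Suc k) (a(k + 1 := a (k + 1) + j)) z)"
proof -
  let ?x = "z (k + 2)"
  define W where "W j = V (Suc k) (a(k + 1 := a (k + 1) + j)) z" for j
  have W: "V (Suc k) (a(k + 1 := a (k + 1) + j)) (z(k + 2 := y)) = W j" for j y
    unfolding W_def by (rule V_cong) auto
  have absorb: "of_nat (Suc m choose j) * (of_nat (Suc m - j) * ?x ^ (Suc m - j - 1)) =
      of_nat (Suc m) * (of_nat (m choose j) * ?x ^ (m - j))" if "j \<le> m" for j
  proof -
    have "(Suc m - j) * (Suc m choose j) = Suc m * (m choose j)"
      using binomial_absorb_comp[of "Suc m" j] by simp
    then have "of_nat (Suc m - j) * of_nat (Suc m choose j) =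
        (of_nat (Suc m) * of_nat (m choose j) :: complex)"
      by (metis of_nat_mult)
    then show ?thesis
      by (simp add: mult_ac)
  qed
  have "V (Suc (Suc k)) a (z(k + 2 := ?x + 1)) =
      1 / of_nat (Suc m) * (\<Sum>j=0..Suc m. of_nat (Suc m choose j) *
        bernoulli_poly (Suc m - j) (?x + 1) * W j)"
    using assms W by simp
  also have "\<dots> = V (Suc (Suc k)) a z + 1 / of_nat (Suc m) * (\<Sum>j=0..Suc m.
      of_nat (Suc m choose j) * (of_nat (Suc m - j) * ?x ^ (Suc m - j - 1)) * W j)"
    using assms by (simp only: V.simps W_def bernoulli_poly_plus_1 ring_distribs sum.distrib)
  \<comment> \<open>The top term \<open>j = Suc m\<close> drops out: it belongs to the constant
    polynomial of degree 0, whose difference is zero.\<close>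
  also have "(\<Sum>j=0..Suc m.
      of_nat (Suc m choose j) * (of_nat (Suc m - j) * ?x ^ (Suc m - j - 1)) * W j) =
      (\<Sum>j=0..m. of_nat (Suc m choose j) * (of_nat (Suc m - j) * ?x ^ (Suc m - j - 1)) * W j)"
    by simp
  also have "\<dots> = (\<Sum>j=0..m. of_nat (Suc m) * (of_nat (m choose j) * ?x ^ (m - j)) * W j)"
    by (intro sum.cong refl, subst absorb) auto
  also have "\<dots> = of_nat (Suc m) * (\<Sum>j=0..m. of_nat (m choose j) * ?x ^ (m - j) * W j)"
    by (simp only: sum_distrib_left mult.assoc)
  also have "1 / of_nat (Suc m) * \<dots> = (\<Sum>j=0..m. of_nat (m choose j) * ?x ^ (m - j) * W j)"
    by (simp del: of_nat_Suc)
  finally show ?thesis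
    unfolding W_def .
qed

text \<open>Binomial expansion of the power of \<open>x\<close> minus the symbol. The leading
  coefficient \<open>(-1) ^ m\<close> is nonzero, so the degree is exactly \<open>m\<close> and no
  term of the sum is lost.\<close>

lemma umbral_eval_linear_power:
  "umbral_eval f ([:x, -1:] ^ m) =
     (\<Sum>k=0..m. of_nat (m choose k) * x ^ (m - k) * (-1) ^ k * f k)"
proof -
  have "degree ([:x, -1:] ^ m) = m"
    by (simp add: degree_power_eq)
  then show ?thesis
    unfolding umbral_eval_def atMost_atLeast0
    by (auto intro!: sum.cong simp: coeff_linear_poly_power)
qed

theorem theorem4:
  fixes r :: nat and n :: "nat \<Rightarrow> nat" and z :: "nat \<Rightarrow> complex"
  assumes "r \<ge> 2"
  shows "zeta_neg r n (z(r := z r + 1)) =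
           zeta_neg r n z +
           (-1) ^ n r * (\<Sum>k=0..n r. of_nat (n r choose k) * z r ^ (n r - k) * (-1) ^ k *
                           zeta_neg (r - 1) (n(r - 1 := n (r - 1) + k)) z)
       \<and> (-1) ^ n r * (\<Sum>k=0..n r. of_nat (n r choose k) * z r ^ (n r - k) * (-1) ^ k *
                           zeta_neg (r - 1) (n(r - 1 := n (r - 1) + k)) z) =
           (-1) ^ n r * umbral_eval (\<lambda>k. zeta_neg (r - 1) (n(r - 1 := n (r - 1) + k)) z)
                          ([:z r, -1:] ^ n r)"
proof (intro conjI)
  obtain s where r: "r = Suc (Suc s)"
    using assms that[of "r - 2"] by simp
  define S where "S = (\<Sum>i=1..Suc s. n i)"
  define W where "W k = V (Suc s) ((\<lambda>i. n i + 1)(s + 1 := n (s + 1) + 1 + k)) z" for k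
  \<comment> \<open>Raising the last exponent by \<open>k\<close> adds a sign
    \<open>(-1) ^ k\<close> to \<open>zeta_neg\<close>; the explicit factor \<open>(-1) ^ k\<close>
    cancels it and leaves a sign independent of \<open>k\<close>.\<close>
  have zeta: "(-1) ^ k * zeta_neg (r - 1) (n(r - 1 := n (r - 1) + k)) z = (-1) ^ S * W k" for k
  proof -
    have "(\<Sum>i=1..Suc s. (n(s + 1 := n (s + 1) + k)) i) = S + k"
      by (simp add: S_def)
    moreover have "(\<lambda>i. (n(s + 1 := n (s + 1) + k)) i + 1) =
        (\<lambda>i. n i + 1)(s + 1 := n (s + 1) + 1 + k)"
      by auto
    ultimately have "zeta_neg (r - 1) (n(r - 1 := n (r - 1) + k)) z = (-1) ^ (S + k) * W k"
      by (simp only: zeta_neg_def r W_def Suc_eq_plus1 add_diff_cancel_right')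
    then show ?thesis
      by (simp add: power_add)
  qed
  have "zeta_neg r n (z(r := z r + 1)) = (-1) ^ (S + n r) *
      V (Suc (Suc s)) (\<lambda>i. n i + 1) (z(s + 2 := z (s + 2) + 1))"
    by (simp add: zeta_neg_def r S_def)
  also have "\<dots> = (-1) ^ (S + n r) * (V (Suc (Suc s)) (\<lambda>i. n i + 1) z +
      (\<Sum>k=0..n r. of_nat (n r choose k) * z r ^ (n r - k) * W k))"
    \<comment> \<open>The last argument of \<open>V\<close> is \<open>n r + 1\<close>, hence this
      choice of \<open>m\<close>.\<close>
    by (subst V_shift_last[where m = "n r"]) (simp_all add: r W_def)
  also have "\<dots> = zeta_neg r n z + (-1) ^ n r *
      (\<Sum>k=0..n r. of_nat (n r choose k) * z r ^ (n r - k) * ((-1) ^ S * W k))"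
    by (simp add: zeta_neg_def r S_def power_add ring_distribs sum_distrib_left mult_ac
        del: V.simps)
  also have "\<dots> = zeta_neg r n z + (-1) ^ n r *
      (\<Sum>k=0..n r. of_nat (n r choose k) * z r ^ (n r - k) * (-1) ^ k *
        zeta_neg (r - 1) (n(r - 1 := n (r - 1) + k)) z)"
    by (simp only: mult.assoc flip: zeta)
  finally show "zeta_neg r n (z(r := z r + 1)) = zeta_neg r n z + (-1) ^ n r *
      (\<Sum>k=0..n r. of_nat (n r choose k) * z r ^ (n r - k) * (-1) ^ k *
        zeta_neg (r - 1) (n(r - 1 := n (r - 1) + k)) z)" .
qed (simp only: umbral_eval_linear_power)

end
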